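(* Let $\mathcal{H}_n$ be an $n$-dimensional Hilbert space, let $K$ be a linear operator on $\mathcal{H}_n$, let $F=\{f_i\}_{i\in I_m}$ be a $K$-frame of $\mathcal{H}_n$, and suppose that $\sigma\subset I_m$ satisfies the minimal redundancy condition (MRC) for $F$. Then: (i) $R(\theta_F^{*}K)\cap\mathrm{span}\{\delta_i\}_{i\in\sigma}=\{0\}$. (ii) If $F$ is a Parseval $K$-frame, then $(K-\theta_\sigma\xi_\sigma^{*})|_{R(K^{\dagger})}$ is an invertible operator from $R(K^{\dagger})$ onto $S_{\sigma^c}(R(K))$.
   Context: $I_m=\{1,\dots,m\}$; $\sigma^c=I_m\setminus\sigma$; $\{\delta_i\}_{i\in I_m}$ is the standard orthonormal basis of $l^2(I_m)=\mathbb{C}^m$; $R(T)$ denotes range; $K^{\dagger}$ is the Moore–Penrose pseudo-inverse of $K$; inner products are linear in the first variable. For $F=\{f_i\}_{i\in I_m}\subseteq\mathcal{H}_n$, $\theta_F:l^2(I_m)\to\mathcal{H}_n$, $\theta_F\{c_i\}=\sum_ic_if_i$ is the synthesis operator, $\theta_F^{*}f=\{\langle f,f_i\rangle\}_i$ the analysis operator, $S_F=\theta_F\theta_F^{*}$ the frame operator. $F$ is a $K$-frame if $R(K)\subseteq R(\theta_F)=\mathrm{span}\{f_i\}$; it is a Parseval $K$-frame if in addition $S_F=KK^{*}$. A set $\sigma\subset I_m$ satisfies MRC for $F$ if $\{f_i\}_{i\in\sigma^c}$ is a $K$-frame for $\mathcal{H}_n$. A $K$-dual of $F$ is a sequence $G=\{g_i\}_{i\in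 I_m}$ with $\theta_F\theta_G^{*}=K$. For a $K$-frame $F$ there is a unique operator $X_F:\mathcal{H}_n\to l^2(I_m)$ with $\theta_FX_F=K$ and $R(X_F)\subseteq R(\theta_F^{*})$; the canonical $K$-dual of $F$ is $\{X_F^{*}\delta_i\}_{i\in I_m}$. For an index set $\tau\subseteq I_m$, $\theta_\tau$ and $S_\tau$ are the synthesis and frame operators of $\{f_i\}_{i\in\tau}$ (so $S_\tau f=\sum_{i\in\tau}\langle f,f_i\rangle f_i$), and $\xi_\tau^{*}$ is the analysis operator of the canonical $K$-dual of $F$ with index set restricted to $\tau$, i.e. $\xi_\tau^{*}f=\{\langle f,X_F^{*}\delta_i\rangle\}_{i\in\tau}$. *)

theory Defs
  imports "HOL-Analysis.Analysis"
begin

(* Complex vector spaces and complex inner product spaces, with the inner product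
   linear in its first argument.  No norm or completeness axiom is included: the spaces
   considered are finite-dimensional, so they are complete for the norm induced by cinner
   and all linear maps between them are bounded. *)

class complex_vec_space = ab_group_add +
  fixes scaleC :: "complex \<Rightarrow> 'a \<Rightarrow> 'a" (infixr "*\<^sub>C" 75)
  assumes scaleC_add_right: "a *\<^sub>C (x + y) = a *\<^sub>C x + a *\<^sub>C y"
    and scaleC_add_left: "(a + b) *\<^sub>C x = a *\<^sub>C x + b *\<^sub>C x"
    and scaleC_scaleC: "a *\<^sub>C (b *\<^sub>C x) = (a * b) *\<^sub>C x"
    and scaleC_one: "1 *\<^sub>C x = x"

class complex_inner_space = complex_vec_space +
  fixes cinner :: "'a \<Rightarrow> 'a \<Rightarrow> complex"
  assumes cinner_add_left: "cinner (x + y) z = cinner x z + cinner y z"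
    and cinner_scaleC_left: "cinner (c *\<^sub>C x) y = c * cinner x y"
    and cinner_commute: "cinner x y = cnj (cinner y x)"
    and cinner_self_nonneg: "0 \<le> Re (cinner x x)"
    and cinner_eq_zero_iff: "cinner x x = 0 \<longleftrightarrow> x = 0"

global_interpretation complex_vector: vector_space "scaleC :: complex \<Rightarrow> 'a \<Rightarrow> 'a::complex_vec_space"
  by standard (simp_all add: scaleC_add_right scaleC_add_left scaleC_scaleC scaleC_one)

abbreviation clinear :: "('a::complex_vec_space \<Rightarrow> 'b::complex_vec_space) \<Rightarrow> bool"
  where "clinear \<equiv> Vector_Spaces.linear scaleC scaleC"

instantiation complex :: complex_inner_space
begin

definition scaleC_complex :: "complex \<Rightarrow> complex \<Rightarrow> complex"
  where "scaleC_complex c x = c * x"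

definition cinner_complex :: "complex \<Rightarrow> complex \<Rightarrow> complex"
  where "cinner_complex x y = x * cnj y"

instance
  by standard
    (auto simp: scaleC_complex_def cinner_complex_def algebra_simps)

end

instantiation vec :: (complex_vec_space, finite) complex_vec_space
begin

definition scaleC_vec :: "complex \<Rightarrow> 'a ^ 'b \<Rightarrow> 'a ^ 'b"
  where "scaleC_vec c x = (\<chi> i. c *\<^sub>C (x $ i))"

instance
  by standard
    (simp_all add: scaleC_vec_def vec_eq_iff scaleC_add_right scaleC_add_left
      scaleC_scaleC scaleC_one)

end

(* In particular complex ^ 'm is the space l2 of the index set, with its standard inner
   product. *)
instantiation vec :: (complex_inner_space, finite) complex_inner_space
begin

definition cinner_vec :: "'a ^ 'b \<Rightarrow> 'a ^ 'b \<Rightarrow> complex"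
  where "cinner_vec x y = (\<Sum>i\<in>UNIV. cinner (x $ i) (y $ i))"

instance
proof
  fix x y z :: "'a ^ 'b" and c :: complex
  show "cinner (x + y) z = cinner x z + cinner y z"
    by (simp add: cinner_vec_def cinner_add_left sum.distrib)
  show "cinner (c *\<^sub>C x) y = c * cinner x y"
    by (simp add: cinner_vec_def scaleC_vec_def cinner_scaleC_left sum_distrib_left)
  show "cinner x y = cnj (cinner y x)"
    unfolding cinner_vec_def cnj_sum by (intro sum.cong refl cinner_commute)
  show "0 \<le> Re (cinner x x)"
    by (simp add: cinner_vec_def sum_nonneg cinner_self_nonneg)
  have im: "Im (cinner a a) = 0" for a :: 'a
    using arg_cong[OF cinner_commute[of a a], of Im] by simp
  have "cinner x x = 0 \<longleftrightarrow> (\<Sum>i\<in>UNIV. Re (cinner (x $ i) (x $ i))) = 0"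
    by (simp add: cinner_vec_def complex_eq_iff im)
  also have "\<dots> \<longleftrightarrow> (\<forall>i. Re (cinner (x $ i) (x $ i)) = 0)"
    by (subst sum_nonneg_eq_0_iff) (auto simp: cinner_self_nonneg)
  also have "\<dots> \<longleftrightarrow> (\<forall>i. cinner (x $ i) (x $ i) = 0)"
    by (simp add: complex_eq_iff im)
  also have "\<dots> \<longleftrightarrow> x = 0"
    by (simp add: cinner_eq_zero_iff vec_eq_iff)
  finally show "cinner x x = 0 \<longleftrightarrow> x = 0" .
qed

end

definition cadjoint :: "('a::complex_inner_space \<Rightarrow> 'b::complex_inner_space) \<Rightarrow> 'b \<Rightarrow> 'a"
  where "cadjoint T = (THE T'. \<forall>x y. cinner (T x) y = cinner x (T' y))"

(* The Moore-Penrose pseudo-inverse, characterised by the four Penrose equations. *)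
definition pseudo_inverse :: "('a::complex_inner_space \<Rightarrow> 'b::complex_inner_space) \<Rightarrow> 'b \<Rightarrow> 'a"
  where "pseudo_inverse K =
    (THE X. clinear X \<and> K \<circ> X \<circ> K = K \<and> X \<circ> K \<circ> X = X \<and>
       cadjoint (K \<circ> X) = K \<circ> X \<and> cadjoint (X \<circ> K) = X \<circ> K)"

(* A subfamily of F indexed by t has coefficient space l2(t), which is identified with the
   vectors of complex ^ 'm vanishing outside t: synthesis F t only uses the coordinates in t,
   and analysis F t extends the coefficient sequence by zero.  The whole family is obtained
   for t = UNIV. *)
definition synthesis :: "('m \<Rightarrow> 'h) \<Rightarrow> 'm set \<Rightarrow> complex ^ 'm \<Rightarrow> 'h::complex_inner_space"
  where "synthesis F t c = (\<Sum>i\<in>t. (c $ i) *\<^sub>C F i)"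

definition analysis :: "('m \<Rightarrow> 'h) \<Rightarrow> 'm set \<Rightarrow> 'h::complex_inner_space \<Rightarrow> complex ^ 'm"
  where "analysis F t f = (\<chi> i. if i \<in> t then cinner f (F i) else 0)"

definition frame_operator ::
    "('m::finite \<Rightarrow> 'h) \<Rightarrow> 'm set \<Rightarrow> 'h \<Rightarrow> 'h::complex_inner_space"
  where "frame_operator F t = synthesis F t \<circ> analysis F t"

definition K_frame ::
    "('h \<Rightarrow> 'h) \<Rightarrow> ('m::finite \<Rightarrow> 'h::complex_inner_space) \<Rightarrow> 'm set \<Rightarrow> bool"
  where "K_frame K F t \<longleftrightarrow> range K \<subseteq> range (synthesis F t)"

lemma range_synthesis:
  fixes F :: "'m::finite \<Rightarrow> 'h::complex_inner_space"
  shows "range (synthesis F t) = complex_vector.span (F ` t)"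
proof (intro equalityI subsetI)
  fix x assume "x \<in> range (synthesis F t)"
  then show "x \<in> complex_vector.span (F ` t)"
    by (auto simp: synthesis_def
        intro: complex_vector.span_sum complex_vector.span_scale complex_vector.span_base)
next
  fix x assume "x \<in> complex_vector.span (F ` t)"
  then show "x \<in> range (synthesis F t)"
  proof (induction rule: complex_vector.span_induct_alt)
    case base
    have "0 = synthesis F t 0" by (simp add: synthesis_def)
    then show ?case by blast
  next
    case (step c x y)
    from step obtain j d where j: "j \<in> t" "x = F j" and d: "y = synthesis F t d" by blast
    have "synthesis F t (d + axis j c) = y + (\<Sum>i\<in>t. if i = j then c *\<^sub>C F j else 0)"
      unfolding d synthesis_def sum.distrib[symmetric]
      by (rule sum.cong) (auto simp: axis_def scaleC_add_left)
    also have "\<dots> = c *\<^sub>C x + y" using j by (simp add: sum.delta)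
    finally show ?case by (metis rangeI)
  qed
qed

definition parseval_K_frame ::
    "('h \<Rightarrow> 'h) \<Rightarrow> ('m::finite \<Rightarrow> 'h::complex_inner_space) \<Rightarrow> 'm set \<Rightarrow> bool"
  where "parseval_K_frame K F t \<longleftrightarrow>
    K_frame K F t \<and> frame_operator F t = K \<circ> cadjoint K"

definition MRC :: "('h \<Rightarrow> 'h) \<Rightarrow> ('m::finite \<Rightarrow> 'h::complex_inner_space) \<Rightarrow> 'm set \<Rightarrow> bool"
  where "MRC K F \<sigma> \<longleftrightarrow> K_frame K F (- \<sigma>)"

(* X is the coefficient operator with values in the range of the analysis operator; it exists
   and is unique for every K-frame F. *)
definition canonical_coeff_op ::
    "('h \<Rightarrow> 'h) \<Rightarrow> ('m::finite \<Rightarrow> 'h) \<Rightarrow> 'h::complex_inner_space \<Rightarrow> complex ^ 'm"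
  where "canonical_coeff_op K F =
    (THE X. clinear X \<and> synthesis F UNIV \<circ> X = K \<and> range X \<subseteq> range (analysis F UNIV))"

definition canonical_K_dual ::
    "('h \<Rightarrow> 'h) \<Rightarrow> ('m::finite \<Rightarrow> 'h) \<Rightarrow> 'm \<Rightarrow> 'h::complex_inner_space"
  where "canonical_K_dual K F i = cadjoint (canonical_coeff_op K F) (axis i 1)"

(* The restriction of T to V is an invertible operator from V onto W. *)
definition invertible_operator_on ::
    "('a::complex_vec_space \<Rightarrow> 'b::complex_vec_space) \<Rightarrow> 'a set \<Rightarrow> 'b set \<Rightarrow> bool"
  where "invertible_operator_on T V W \<longleftrightarrow>
    complex_vector.subspace V \<and> complex_vector.subspace W \<and>
    (\<forall>x\<in>V. \<forall>y\<in>V. T (x + y) = T x + T y) \<and>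
    (\<forall>c. \<forall>x\<in>V. T (c *\<^sub>C x) = c *\<^sub>C T x) \<and>
    bij_betw T V W"

end

theory Submission
  imports Defs
begin

text \<open>
  For (i), a vector of the range of \<open>K\<close> whose coefficients vanish outside \<open>\<sigma>\<close> is orthogonal to
  all \<open>F i\<close> with \<open>i \<notin> \<sigma>\<close>, hence by MRC to itself. For (ii), let \<open>A\<close> be the adjoint of the
  pseudo-inverse of \<open>K\<close>. In the Parseval case the canonical coefficient operator is the analysis
  operator composed with \<open>A\<close>, because \<open>K K\<^sup>* A = K\<close>; so the operator in question equals
  \<open>S A\<close>, where \<open>S\<close> is the frame operator of the complement of \<open>\<sigma>\<close>. Finally \<open>A\<close> maps the range
  of the pseudo-inverse bijectively onto the range of \<open>K\<close>, and \<open>S\<close> is injective there by the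
  argument for (i).
\<close>

section \<open>Finite-dimensional complex inner product spaces\<close>

lemma clinear_iff:
  "clinear f \<longleftrightarrow> (\<forall>x y. f (x + y) = f x + f y) \<and> (\<forall>c x. f (c *\<^sub>C x) = c *\<^sub>C f x)"
  by (auto simp: Vector_Spaces.linear_iff complex_vector.vector_space_axioms)

lemma clinear_add: "clinear f \<Longrightarrow> f (x + y) = f x + f y"
  and clinear_scale: "clinear f \<Longrightarrow> f (c *\<^sub>C x) = c *\<^sub>C f x"
  by (simp_all add: clinear_iff)

lemma clinear_diff: "clinear f \<Longrightarrow> f (x - y) = f x - f y"
  by (metis add_diff_cancel clinear_add diff_add_cancel)

lemma clinear_zero: "clinear f \<Longrightarrow> f 0 = 0"
  by (metis clinear_diff diff_self)

lemma clinear_compose: "clinear f \<Longrightarrow> clinear g \<Longrightarrow> clinear (f \<circ> g)"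
  by (simp add: clinear_iff)

lemma clinear_subspace_range:
  assumes "clinear f"
  shows "complex_vector.subspace (range f)"
  unfolding complex_vector.subspace_def
  using clinear_zero[OF assms] clinear_add[OF assms] clinear_scale[OF assms]
  by (auto simp: image_iff) metis+

lemma cinner_diff_left: "cinner (x - y) z = cinner x z - cinner y z"
  by (metis add_diff_cancel cinner_add_left diff_add_cancel)

lemma cinner_zero_left [simp]: "cinner 0 z = 0"
  by (metis cinner_diff_left diff_self)

lemma cinner_zero_right [simp]: "cinner z 0 = 0"
  by (metis cinner_commute cinner_zero_left complex_cnj_zero)

lemma cinner_add_right: "cinner z (x + y) = cinner z x + cinner z y"
  by (metis cinner_add_left cinner_commute complex_cnj_add)

lemma cinner_diff_right: "cinner z (x - y) = cinner z x - cinner z y"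
  by (metis cinner_diff_left cinner_commute complex_cnj_diff)

lemma cinner_scaleC_right: "cinner x (c *\<^sub>C y) = cnj c * cinner x y"
  by (metis cinner_scaleC_left cinner_commute complex_cnj_mult)

lemma cinner_sum_left: "cinner (\<Sum>i\<in>t. f i) z = (\<Sum>i\<in>t. cinner (f i) z)"
  by (induction t rule: infinite_finite_induct) (simp_all add: cinner_add_left)

lemma cinner_zero_commute: "cinner x y = 0 \<longleftrightarrow> cinner y x = 0"
  by (metis cinner_commute complex_cnj_zero)

lemma cinner_ext: "(\<And>z. cinner z x = cinner z y) \<Longrightarrow> x = y"
  by (metis cinner_diff_right cinner_eq_zero_iff eq_iff_diff_eq_0)

lemma cinner_span_eq_0:
  assumes "x \<in> complex_vector.span S" and "\<And>s. s \<in> S \<Longrightarrow> cinner s z = 0"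
  shows "cinner x z = 0"
  using assms
  by (induction rule: complex_vector.span_induct_alt)
     (simp_all add: cinner_add_left cinner_scaleC_left)

text \<open>Nondegeneracy of the inner product fixes an adjoint pointwise, so one candidate already
  settles the definite description; self-adjointness is proved this way below.\<close>

lemma cadjoint_unique:
  assumes "\<And>x y. cinner (T x) y = cinner x (T' y)"
  shows "cadjoint T = T'"
  unfolding cadjoint_def
proof (rule the_equality)
  show "\<forall>x y. cinner (T x) y = cinner x (T' y)"
    using assms by blast
  show "S = T'" if "\<forall>x y. cinner (T x) y = cinner x (S y)" for S
    by (rule ext, rule cinner_ext) (simp flip: assms add: that)
qed

text \<open>Gram-Schmidt, one vector at a time: \<open>b\<close> is the part of the new vector
  \<open>a\<close> orthogonal to the old span, and the old projection \<open>r\<close> is corrected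
  along \<open>b\<close>.\<close>

lemma finite_span_projection:
  fixes S :: "'h::complex_inner_space set"
  assumes "finite S"
  shows "\<exists>p \<in> complex_vector.span S. \<forall>s \<in> complex_vector.span S. cinner s (x - p) = 0"
  using assms
proof (induction S arbitrary: x rule: finite_induct)
  case empty
  then show ?case by simp
next
  case (insert a S)
  have sub: "complex_vector.span S \<subseteq> complex_vector.span (insert a S)"
    by (intro complex_vector.span_mono) auto
  obtain q where q: "q \<in> complex_vector.span S"
    "\<And>s. s \<in> complex_vector.span S \<Longrightarrow> cinner s (a - q) = 0"
    using insert.IH by blast
  obtain r where r: "r \<in> complex_vector.span S"
    "\<And>s. s \<in> complex_vector.span S \<Longrightarrow> cinner s (x - r) = 0"
    using insert.IH by blast
  define b where "b = a - q"
  \<comment> \<open>The coefficient can use \<open>x\<close> in place of \<open>x - r\<close>, since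
    \<open>r\<close> is orthogonal to \<open>b\<close>. If \<open>b = 0\<close>, the added term
    vanishes and \<open>p = r\<close>.\<close>
  define p where "p = r + (cinner x b / cinner b b) *\<^sub>C b"
  have b_in: "b \<in> complex_vector.span (insert a S)"
    unfolding b_def using q(1) sub
    by (intro complex_vector.span_diff) (auto intro: complex_vector.span_base)
  have p_in: "p \<in> complex_vector.span (insert a S)"
    unfolding p_def using r(1) sub b_in
    by (auto intro!: complex_vector.span_add complex_vector.span_scale)
  have orth_S: "cinner s (x - p) = 0" if "s \<in> complex_vector.span S" for s
    using q(2)[OF that] r(2)[OF that]
    by (simp add: p_def b_def[symmetric] cinner_diff_right cinner_add_right cinner_scaleC_right)
  have "cinner r b = 0"
    using q(2)[OF r(1)] by (simp add: b_def)
  then have "cinner (x - p) b = 0"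
    by (cases "b = 0")
       (simp_all add: p_def cinner_diff_left cinner_add_left cinner_scaleC_left cinner_eq_zero_iff)
  then have orth_b: "cinner b (x - p) = 0"
    using cinner_zero_commute by blast
  have "a = b + q"
    by (simp add: b_def)
  then have "cinner a (x - p) = 0"
    using orth_b orth_S[OF q(1)] by (simp add: cinner_add_left)
  then have "cinner s (x - p) = 0" if "s \<in> complex_vector.span (insert a S)" for s
    using that orth_S by (elim cinner_span_eq_0) (auto intro: complex_vector.span_base)
  with p_in show ?case by blast
qed

section \<open>Projections, adjoints and the pseudo-inverse in finite dimension\<close>

context
  fixes B :: "'h::complex_inner_space set"
  assumes finite_basis: "finite B" and span_basis: "complex_vector.span B = UNIV"
begin

text \<open>An independent subset of \<open>V\<close> is no larger than \<open>B\<close>, so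
  \<open>V\<close> is the span of a finite set.\<close>

lemma subspace_projection:
  assumes "complex_vector.subspace (V :: 'h set)"
  shows "\<exists>p \<in> V. \<forall>s \<in> V. cinner s (x - p) = 0"
proof -
  obtain C where C: "C \<subseteq> V" "complex_vector.independent C" "V \<subseteq> complex_vector.span C"
    using complex_vector.maximal_independent_subset by blast
  have "finite C"
    using complex_vector.independent_span_bound[OF finite_basis C(2)] span_basis by auto
  moreover have "complex_vector.span C = V"
    using C assms by (simp add: complex_vector.span_minimal subset_antisym)
  ultimately show ?thesis
    using finite_span_projection by blast
qed

text \<open>For nonzero \<open>\<phi>\<close> the representing vector is a multiple of
  \<open>z\<close>, the component orthogonal to the kernel of some \<open>x\<close> outside
  it.\<close>

lemma riesz_representation:
  fixes \<phi> :: "'h \<Rightarrow> complex"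
  assumes add: "\<And>x y. \<phi> (x + y) = \<phi> x + \<phi> y" and scale: "\<And>c x. \<phi> (c *\<^sub>C x) = c * \<phi> x"
  shows "\<exists>y. \<forall>x. \<phi> x = cinner x y"
proof (cases "\<forall>x. \<phi> x = 0")
  case True
  then show ?thesis by (intro exI[of _ 0]) simp
next
  case False
  then obtain x where x: "\<phi> x \<noteq> 0" by blast
  have diff: "\<phi> (u - v) = \<phi> u - \<phi> v" for u v
    by (metis add add_diff_cancel diff_add_cancel)
  have "\<phi> 0 = 0" by (metis diff diff_self)
  then have "complex_vector.subspace {u. \<phi> u = 0}"
    by (simp add: complex_vector.subspace_def add scale)
  then obtain p where p: "\<phi> p = 0" "\<And>s. \<phi> s = 0 \<Longrightarrow> cinner s (x - p) = 0"
    using subspace_projection[of "{u. \<phi> u = 0}" x] by auto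
  define z where "z = x - p"
  have z: "\<phi> z \<noteq> 0"
    using x p by (simp add: z_def diff)
  then have zz: "cinner z z \<noteq> 0"
    using \<open>\<phi> 0 = 0\<close> by (metis cinner_eq_zero_iff)
  have "\<phi> u = cinner u ((cnj (\<phi> z / cinner z z)) *\<^sub>C z)" for u
  proof -
    \<comment> \<open>Subtracting this multiple of \<open>z\<close> moves \<open>u\<close> into the
      kernel, which is orthogonal to \<open>z\<close>.\<close>
    have "\<phi> (u - (\<phi> u / \<phi> z) *\<^sub>C z) = 0"
      using z by (simp add: diff scale)
    then have "cinner (u - (\<phi> u / \<phi> z) *\<^sub>C z) z = 0"
      using p(2) z_def by blast
    then show ?thesis
      using z zz
      by (simp add: cinner_diff_left cinner_scaleC_left cinner_scaleC_right field_simps)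
  qed
  then show ?thesis by blast
qed

text \<open>Riesz on the domain gives an adjoint; the codomain is kept general because it is later
  the coefficient space.\<close>

lemma cinner_cadjoint:
  fixes T :: "'h \<Rightarrow> 'b::complex_inner_space"
  assumes "clinear T"
  shows "cinner (T x) y = cinner x (cadjoint T y)"
proof -
  have "\<exists>z. \<forall>x. cinner (T x) y = cinner x z" for y
    by (rule riesz_representation)
       (simp_all add: clinear_add[OF assms] clinear_scale[OF assms] cinner_add_left cinner_scaleC_left)
  then obtain T' where "\<And>x y. cinner (T x) y = cinner x (T' y)"
    by metis
  then show ?thesis
    using cadjoint_unique by metis
qed

lemma clinear_cadjoint:
  fixes T :: "'h \<Rightarrow> 'b::complex_inner_space"
  assumes "clinear T"
  shows "clinear (cadjoint T)"
  unfolding clinear_iff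
  by (intro conjI allI; rule cinner_ext)
     (simp_all add: cinner_add_right cinner_scaleC_right flip: cinner_cadjoint[OF assms])

text \<open>Linearity and uniqueness of the pseudo-inverse are read off its least-squares description:
  \<open>X y\<close> is orthogonal to the kernel of \<open>K\<close>, and \<open>K (X y)\<close> is the projection of \<open>y\<close> onto the range
  of \<open>K\<close>.\<close>

definition least_squares :: "('h \<Rightarrow> 'h) \<Rightarrow> 'h \<Rightarrow> 'h \<Rightarrow> bool"
  where "least_squares K y x \<longleftrightarrow>
    (\<forall>v. K v = 0 \<longrightarrow> cinner v x = 0) \<and> (\<forall>u. cinner (K u) (y - K x) = 0)"

text \<open>\<open>K (x - x')\<close> is in the range of \<open>K\<close> and orthogonal to it, so
  zero. Then \<open>x - x'\<close> is in the kernel, hence orthogonal to \<open>x\<close> and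
  \<open>x'\<close> and so to itself.\<close>

lemma least_squares_unique:
  assumes K: "clinear K" and "least_squares K y x" "least_squares K y x'"
  shows "x = x'"
proof -
  have orth: "cinner (K u) (y - K x) = 0" "cinner (K u) (y - K x') = 0" for u
    using assms by (auto simp: least_squares_def)
  have "cinner (K u) (K (x - x')) = 0" for u
    using orth[of u] by (simp add: cinner_diff_right clinear_diff[OF K])
  then have "K (x - x') = 0"
    using cinner_eq_zero_iff by blast
  then have "cinner (x - x') x = 0" "cinner (x - x') x' = 0"
    using assms by (auto simp: least_squares_def)
  then have "cinner (x - x') (x - x') = 0"
    by (simp add: cinner_diff_right)
  then show ?thesis by (simp add: cinner_eq_zero_iff)
qed

text \<open>Take \<open>u\<close> with \<open>K u\<close> the projection of \<open>y\<close> onto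
  the range; removing the kernel component of \<open>u\<close> leaves \<open>K u\<close>
  unchanged.\<close>

lemma least_squares_exists:
  assumes K: "clinear K"
  shows "\<exists>x. least_squares K y x"
proof -
  obtain u where u: "\<And>v. cinner (K v) (y - K u) = 0"
    using subspace_projection[OF clinear_subspace_range[OF K], of y] by auto
  have "complex_vector.subspace {v. K v = 0}"
    by (simp add: complex_vector.subspace_def clinear_zero[OF K] clinear_add[OF K]
        clinear_scale[OF K])
  then obtain p where p: "K p = 0" "\<And>v. K v = 0 \<Longrightarrow> cinner v (u - p) = 0"
    using subspace_projection[of "{v. K v = 0}" u] by auto
  have "least_squares K y (u - p)"
    using u p by (simp add: least_squares_def clinear_diff[OF K])
  then show ?thesis by blast
qed

text \<open>The Penrose equations make \<open>K \<circ> X\<close> and \<open>X \<circ> K\<close>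
  self-adjoint idempotents: the first fixes the range of \<open>K\<close>, the second fixes the
  range of \<open>X\<close> and kills the kernel of \<open>K\<close>.\<close>

lemma penrose_least_squares:
  fixes K X :: "'h \<Rightarrow> 'h"
  assumes K: "clinear K" and X: "clinear X"
    and KXK: "K \<circ> X \<circ> K = K" and XKX: "X \<circ> K \<circ> X = X"
    and KX: "cadjoint (K \<circ> X) = K \<circ> X" and XK: "cadjoint (X \<circ> K) = X \<circ> K"
  shows "least_squares K y (X y)"
  unfolding least_squares_def
proof (intro conjI allI impI)
  have eqs: "K (X (K u)) = K u" "X (K (X u)) = X u" for u
    using KXK XKX by (metis comp_apply)+
  show "cinner v (X y) = 0" if "K v = 0" for v
    using cinner_cadjoint[OF clinear_compose[OF X K], of v "X y"] that
    by (simp add: XK eqs clinear_zero[OF X])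
  show "cinner (K u) (y - K (X y)) = 0" for u
    using cinner_cadjoint[OF clinear_compose[OF K X], of "K u" "y - K (X y)"]
    by (simp add: KX eqs clinear_diff[OF X] clinear_diff[OF K] clinear_zero[OF K])
qed

lemma penrose_exists:
  fixes K :: "'h \<Rightarrow> 'h"
  assumes K: "clinear K"
  shows "\<exists>X. clinear X \<and> K \<circ> X \<circ> K = K \<and> X \<circ> K \<circ> X = X \<and>
    cadjoint (K \<circ> X) = K \<circ> X \<and> cadjoint (X \<circ> K) = X \<circ> K"
proof -
  obtain X where X: "\<And>y. least_squares K y (X y)"
    using least_squares_exists[OF K] by metis
  have ker: "cinner v (X y) = 0" if "K v = 0" for v y
    using X that by (auto simp: least_squares_def)
  have ran: "cinner (K u) (y - K (X y)) = 0" for u y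
    using X by (auto simp: least_squares_def)
  \<comment> \<open>Sums and multiples of least-squares solutions solve the combined problem, so
    uniqueness makes the chosen \<open>X\<close> linear.\<close>
  have "X (x + y) = X x + X y" for x y
    using ran[of _ x] ran[of _ y]
    by (intro least_squares_unique[OF K X])
       (simp add: least_squares_def ker cinner_add_right cinner_diff_right clinear_add[OF K])
  moreover have "X (c *\<^sub>C x) = c *\<^sub>C X x" for c x
    using ran[of _ x]
    by (intro least_squares_unique[OF K X])
       (simp add: least_squares_def ker cinner_diff_right cinner_scaleC_right clinear_scale[OF K])
  ultimately have lin: "clinear X"
    by (simp add: clinear_iff)
  have KXK: "K (X (K u)) = K u" for u
  proof -
    have "cinner (K (u - X (K u))) (K u - K (X (K u))) = 0"
      by (rule ran)
    then show ?thesis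
      by (simp add: clinear_diff[OF K] cinner_eq_zero_iff)
  qed
  have XKX: "X (K (X y)) = X y" for y
    by (rule least_squares_unique[OF K X]) (simp add: least_squares_def ker)
  have "cadjoint (K \<circ> X) = K \<circ> X"
  proof (rule cadjoint_unique)
    fix y z
    \<comment> \<open>Residuals are orthogonal to the range of \<open>K\<close>, so both sides equal
      the symmetric expression \<open>cinner (K (X y)) (K (X z))\<close>.\<close>
    have "cinner (K (X y)) z = cinner (K (X y)) (K (X z))"
      using ran[of "X y" z] by (simp add: cinner_diff_right)
    also have "\<dots> = cinner y (K (X z))"
      using ran[of "X z" y] cinner_zero_commute[of "K (X z)"] by (simp add: cinner_diff_left)
    finally show "cinner ((K \<circ> X) y) z = cinner y ((K \<circ> X) z)" by simp
  qed
  moreover have "cadjoint (X \<circ> K) = X \<circ> K"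
  proof (rule cadjoint_unique)
    fix y z
    \<comment> \<open>\<open>u - X (K u)\<close> lies in the kernel of \<open>K\<close>, to which
      every value of \<open>X\<close> is orthogonal.\<close>
    have orth: "cinner (u - X (K u)) (X v) = 0" for u v
      by (rule ker) (simp add: clinear_diff[OF K] KXK)
    have "cinner (X (K y)) z = cinner (X (K y)) (X (K z))"
      using orth[of z "K y"] cinner_zero_commute[of "z - X (K z)"] by (simp add: cinner_diff_right)
    also have "\<dots> = cinner y (X (K z))"
      using orth[of y "K z"] by (simp add: cinner_diff_left)
    finally show "cinner ((X \<circ> K) y) z = cinner y ((X \<circ> K) z)" by simp
  qed
  moreover have "K \<circ> X \<circ> K = K" "X \<circ> K \<circ> X = X"
    by (simp_all add: fun_eq_iff KXK XKX)
  ultimately show ?thesis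
    using lin by blast
qed

text \<open>Any two solutions of the Penrose equations agree pointwise, both being the least-squares
  solution, so the definite description denotes.\<close>

lemma pseudo_inverse_penrose:
  fixes K :: "'h \<Rightarrow> 'h"
  assumes K: "clinear K"
  defines "X \<equiv> pseudo_inverse K"
  shows "clinear X \<and> K \<circ> X \<circ> K = K \<and> X \<circ> K \<circ> X = X \<and>
    cadjoint (K \<circ> X) = K \<circ> X \<and> cadjoint (X \<circ> K) = X \<circ> K"
proof -
  have "\<exists>!X. clinear X \<and> K \<circ> X \<circ> K = K \<and> X \<circ> K \<circ> X = X \<and>
    cadjoint (K \<circ> X) = K \<circ> X \<and> cadjoint (X \<circ> K) = X \<circ> K"
  proof (rule ex_ex1I[OF penrose_exists[OF K]])
    fix X Y
    assume "clinear X \<and> K \<circ> X \<circ> K = K \<and> X \<circ> K \<circ> X = X \<and>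
        cadjoint (K \<circ> X) = K \<circ> X \<and> cadjoint (X \<circ> K) = X \<circ> K"
      and "clinear Y \<and> K \<circ> Y \<circ> K = K \<and> Y \<circ> K \<circ> Y = Y \<and>
        cadjoint (K \<circ> Y) = K \<circ> Y \<and> cadjoint (Y \<circ> K) = Y \<circ> K"
    then show "X = Y"
      by (metis ext K least_squares_unique penrose_least_squares)
  qed
  from theI'[OF this] show ?thesis
    unfolding X_def pseudo_inverse_def .
qed

text \<open>With \<open>X\<close> the pseudo-inverse and \<open>A\<close> its adjoint,
  \<open>cadjoint K \<circ> A\<close> is the adjoint of \<open>X \<circ> K\<close>, hence
  \<open>X \<circ> K\<close> itself, and \<open>K \<circ> X \<circ> K = K\<close> gives the first
  claim.\<close>

lemma
  fixes K :: "'h \<Rightarrow> 'h"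
  assumes K: "clinear K"
  shows comp_cadjoint_pseudo_inverse:
      "\<And>f. K (cadjoint K (cadjoint (pseudo_inverse K) f)) = K f"
    and bij_betw_cadjoint_pseudo_inverse:
      "bij_betw (cadjoint (pseudo_inverse K)) (range (pseudo_inverse K)) (range K)"
proof -
  define X where "X = pseudo_inverse K"
  define A where "A = cadjoint X"
  have X: "clinear X" and eqs: "\<And>u. K (X (K u)) = K u" "\<And>u. X (K (X u)) = X u"
    and sa: "cadjoint (K \<circ> X) = K \<circ> X" "cadjoint (X \<circ> K) = X \<circ> K"
    using pseudo_inverse_penrose[OF K] unfolding X_def by (auto simp: fun_eq_iff)
  note KX_sa = cinner_cadjoint[OF clinear_compose[OF K X], unfolded sa comp_apply]
  note XK_sa = cinner_cadjoint[OF clinear_compose[OF X K], unfolded sa comp_apply]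
  note adj_K = cinner_cadjoint[OF K]
  note adj_X = cinner_cadjoint[OF X, folded A_def]
  have A: "clinear A"
    unfolding A_def using X by (rule clinear_cadjoint)
  have K_A: "cadjoint K (A f) = X (K f)" for f
    by (rule cinner_ext) (simp flip: adj_K adj_X add: XK_sa)
  show "K (cadjoint K (cadjoint (pseudo_inverse K) f)) = K f" for f
    using K_A eqs by (simp add: A_def X_def)
  \<comment> \<open>Taking adjoints in \<open>X \<circ> K \<circ> X = X\<close> and
    \<open>K \<circ> X \<circ> K = K\<close> places the range of \<open>A\<close> in that of
    \<open>K\<close>, and the range of \<open>cadjoint K\<close> in that of
    \<open>X\<close>.\<close>
  have A_ran: "A f = K (X (A f))" for f
    by (rule cinner_ext) (simp flip: KX_sa adj_X add: eqs)
  have K_adj_ran: "cadjoint K f = X (K (cadjoint K f))" for f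
    by (rule cinner_ext) (simp flip: XK_sa adj_K add: eqs)
  \<comment> \<open>Being self-adjoint, \<open>K \<circ> X\<close> equals
    \<open>A \<circ> cadjoint K\<close>, and it fixes \<open>K w\<close>. This supplies the preimage
    \<open>cadjoint K (K w)\<close> for surjectivity.\<close>
  have K_ran: "K w = A (cadjoint K (K w))" for w
  proof (rule cinner_ext)
    show "cinner z (K w) = cinner z (A (cadjoint K (K w)))" for z
      using KX_sa[of z "K w"] by (simp flip: adj_K adj_X add: eqs)
  qed
  have "bij_betw A (range X) (range K)"
  proof (rule bij_betw_imageI)
    show "inj_on A (range X)"
    proof (rule inj_onI)
      fix x y assume "x \<in> range X" "y \<in> range X" and eq: "A x = A y"
      then obtain u v where uv: "x = X u" "y = X v" by blast
      \<comment> \<open>The kernel of \<open>A\<close> is orthogonal to the range of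
        \<open>X\<close>, so a vector in both is zero.\<close>
      have "A (X (u - v)) = 0"
        using eq by (simp add: uv clinear_diff[OF X] clinear_diff[OF A])
      then have "cinner (X (u - v)) (X (u - v)) = 0"
        by (simp add: adj_X)
      then show "x = y"
        by (simp add: uv cinner_eq_zero_iff clinear_diff[OF X])
    qed
    show "A ` range X = range K"
    proof (intro equalityI subsetI)
      show "y \<in> range K" if "y \<in> A ` range X" for y
        using that A_ran by blast
      show "y \<in> A ` range X" if "y \<in> range K" for y
        using that K_ran K_adj_ran by blast
    qed
  qed
  then show "bij_betw (cadjoint (pseudo_inverse K)) (range (pseudo_inverse K)) (range K)"
    by (simp add: A_def X_def)
qed

end

section \<open>Frames\<close>

lemma clinear_synthesis: "clinear (synthesis F t)"
  by (simp add: clinear_iff synthesis_def scaleC_vec_def scaleC_complex_def sum.distrib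
      scaleC_add_left complex_vector.scale_sum_right)

lemma clinear_analysis: "clinear (analysis F t)"
  by (simp add: clinear_iff analysis_def scaleC_vec_def scaleC_complex_def vec_eq_iff
      cinner_add_left cinner_scaleC_left)

text \<open>Extension by zero in \<open>analysis\<close> matches the coordinates ignored by
  \<open>synthesis\<close>, so the adjoint relation survives restriction to
  \<open>t\<close>.\<close>

lemma cinner_synthesis: "cinner (synthesis F t c) f = cinner c (analysis F t f)"
proof -
  have "(\<Sum>i\<in>t. c $ i * cinner (F i) f)
      = (\<Sum>i\<in>UNIV. if i \<in> t then c $ i * cinner (F i) f else 0)"
    by (simp add: sum.If_cases)
  also have "\<dots> = (\<Sum>i\<in>UNIV. c $ i * cnj (if i \<in> t then cinner f (F i) else 0))"
    by (intro sum.cong refl) (simp flip: cinner_commute)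
  finally show ?thesis
    by (simp add: synthesis_def analysis_def cinner_vec_def cinner_complex_def cinner_sum_left
        cinner_scaleC_left)
qed

lemma analysis_eq_0_iff: "analysis F t f = 0 \<longleftrightarrow> (\<forall>i\<in>t. cinner f (F i) = 0)"
  by (auto simp: analysis_def vec_eq_iff)

text \<open>Pairing \<open>frame_operator F t f\<close> with \<open>f\<close> yields the squared
  norm of \<open>analysis F t f\<close>.\<close>

lemma frame_operator_eq_0_iff: "frame_operator F t f = 0 \<longleftrightarrow> analysis F t f = 0"
proof
  assume "frame_operator F t f = 0"
  then have "cinner (analysis F t f) (analysis F t f) = 0"
    by (simp add: frame_operator_def flip: cinner_synthesis)
  then show "analysis F t f = 0"
    by (simp add: cinner_eq_zero_iff)
qed (simp add: frame_operator_def clinear_zero[OF clinear_synthesis])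

lemma clinear_frame_operator: "clinear (frame_operator F t)"
  unfolding frame_operator_def
  by (intro clinear_compose clinear_synthesis clinear_analysis)

text \<open>\<open>K f\<close> lies in the span of the \<open>F i\<close> with
  \<open>i \<in> t\<close> and is orthogonal to all of them. MRC enters both claims through this
  fact.\<close>

lemma K_frame_analysis_eq_0:
  assumes "K_frame K F t" and "analysis F t (K f) = 0"
  shows "K f = 0"
proof -
  have "K f \<in> complex_vector.span (F ` t)"
    using assms(1) unfolding K_frame_def range_synthesis by blast
  moreover have "cinner s (K f) = 0" if "s \<in> F ` t" for s
    using that assms(2) cinner_zero_commute by (auto simp: analysis_eq_0_iff)
  ultimately show ?thesis
    by (metis cinner_span_eq_0 cinner_eq_zero_iff)
qed

lemma vec_span_axis_outside:
  fixes c :: "complex ^ 'm::finite"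
  assumes "c \<in> complex_vector.span ((\<lambda>i. axis i 1) ` \<sigma>)" and "j \<notin> \<sigma>"
  shows "c $ j = 0"
  using assms
  by (induction rule: complex_vector.span_induct_alt)
     (auto simp: scaleC_vec_def scaleC_complex_def axis_def split: if_splits)

text \<open>The values of two candidates differ by a vector in the range of the analysis operator
  that synthesis annihilates; range and kernel are orthogonal here, so it is zero.\<close>

lemma canonical_coeff_op_unique:
  assumes X: "clinear X" "synthesis F UNIV \<circ> X = K" "range X \<subseteq> range (analysis F UNIV)"
  shows "canonical_coeff_op K F = X"
  unfolding canonical_coeff_op_def
proof (rule the_equality)
  fix Y
  assume Y: "clinear Y \<and> synthesis F UNIV \<circ> Y = K \<and> range Y \<subseteq> range (analysis F UNIV)"
  show "Y = X"
  proof
    fix f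
    obtain g h where gh: "Y f = analysis F UNIV g" "X f = analysis F UNIV h"
      using X(3) Y by (metis imageE rangeI subsetD)
    have "synthesis F UNIV (Y f) = synthesis F UNIV (X f)"
      using X(2) Y by (metis comp_apply)
    then have "frame_operator F UNIV (g - h) = 0"
      by (simp add: frame_operator_def gh clinear_diff[OF clinear_synthesis]
          clinear_diff[OF clinear_analysis])
    then show "Y f = X f"
      by (simp add: frame_operator_eq_0_iff gh clinear_diff[OF clinear_analysis])
  qed
qed (use X in simp)

lemma frame_operator_split_Compl:
  fixes F :: "'m::finite \<Rightarrow> 'h::complex_inner_space"
  shows "frame_operator F UNIV f = frame_operator F \<sigma> f + frame_operator F (- \<sigma>) f"
proof -
  have "frame_operator F t f = (\<Sum>i\<in>t. cinner f (F i) *\<^sub>C F i)" for t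
    by (simp add: frame_operator_def synthesis_def analysis_def)
  then show ?thesis
    using sum.union_disjoint[of \<sigma> "- \<sigma>" "\<lambda>i. cinner f (F i) *\<^sub>C F i"] by simp
qed

theorem theorem4p1:
  fixes B :: "'h::complex_inner_space set" and n :: nat
    and K :: "'h \<Rightarrow> 'h"
    and F :: "'m::finite \<Rightarrow> 'h"
    and \<sigma> :: "'m set"
  assumes "finite_dimensional_vector_space (scaleC :: complex \<Rightarrow> 'h \<Rightarrow> 'h) B" and "card B = n"
    and "clinear K"
    and "K_frame K F UNIV"
    and "MRC K F \<sigma>"
  shows "range (analysis F UNIV \<circ> K) \<inter> complex_vector.span ((\<lambda>i. axis i 1) ` \<sigma>) = {0} \<and>
    (parseval_K_frame K F UNIV \<longrightarrow>
      invertible_operator_on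
        (\<lambda>f. K f - synthesis F \<sigma> (analysis (canonical_K_dual K F) \<sigma> f))
        (range (pseudo_inverse K))
        (frame_operator F (- \<sigma>) ` range K))"
proof (intro conjI impI)
  note K = \<open>clinear K\<close>
  interpret fd: finite_dimensional_vector_space "scaleC :: complex \<Rightarrow> 'h \<Rightarrow> 'h" B
    by fact
  note basis = fd.finite_Basis fd.span_Basis
  have frame: "K_frame K F (- \<sigma>)"
    using \<open>MRC K F \<sigma>\<close> by (simp add: MRC_def)

  \<comment> \<open>Claim (i): coefficient vectors supported in \<sigma>\<close>
  have "analysis F UNIV (K f) = 0"
    if "analysis F UNIV (K f) \<in> complex_vector.span ((\<lambda>i. axis i 1) ` \<sigma>)" for f
  proof -
    have "analysis F (- \<sigma>) (K f) = 0"
      using vec_span_axis_outside[OF that] by (simp add: analysis_def vec_eq_iff)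
    then show ?thesis
      using K_frame_analysis_eq_0[OF frame] clinear_zero[OF clinear_analysis] by metis
  qed
  moreover have "analysis F UNIV (K 0) = 0"
    by (simp add: clinear_zero[OF K] clinear_zero[OF clinear_analysis])
  ultimately show "range (analysis F UNIV \<circ> K) \<inter> complex_vector.span ((\<lambda>i. axis i 1) ` \<sigma>) = {0}"
    by (auto simp: complex_vector.span_zero image_iff intro!: exI[of _ 0] dest: sym)

  \<comment> \<open>Claim (ii): invertibility in the Parseval case\<close>
  assume "parseval_K_frame K F UNIV"
  then have parseval: "frame_operator F UNIV f = K (cadjoint K f)" for f
    by (simp add: parseval_K_frame_def)
  let ?S = "frame_operator F (- \<sigma>)"
  define X where "X = pseudo_inverse K"
  define A where "A = cadjoint X"
  have X: "clinear X"
    using pseudo_inverse_penrose[OF basis K] by (simp add: X_def)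
  note KKA = comp_cadjoint_pseudo_inverse[OF basis K, folded X_def, folded A_def]
  note bij_A = bij_betw_cadjoint_pseudo_inverse[OF basis K, folded X_def, folded A_def]
  have A: "clinear A"
    unfolding A_def using basis X by (rule clinear_cadjoint)
  have coeff: "canonical_coeff_op K F = analysis F UNIV \<circ> A"
  proof (rule canonical_coeff_op_unique)
    show "clinear (analysis F UNIV \<circ> A)"
      using clinear_analysis A by (rule clinear_compose)
    show "synthesis F UNIV \<circ> (analysis F UNIV \<circ> A) = K"
      using parseval KKA by (simp add: fun_eq_iff frame_operator_def)
  qed auto
  \<comment> \<open>Moving the adjoint across, the pairing with \<open>axis i 1\<close> reads off
    coordinate \<open>i\<close> of \<open>analysis F UNIV (A f)\<close>; the dual vectors themselves
    need not be computed.\<close>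
  have dual: "cinner f (canonical_K_dual K F i) = cinner (A f) (F i)" for f i
  proof -
    have "cinner f (canonical_K_dual K F i) = cinner (analysis F UNIV (A f)) (axis i 1)"
      unfolding canonical_K_dual_def coeff
      using cinner_cadjoint[OF basis clinear_compose[OF clinear_analysis A], of F UNIV f] by simp
    also have "\<dots> = cinner (A f) (F i)"
      by (simp add: cinner_vec_def cinner_complex_def analysis_def axis_def
          if_distrib[of "\<lambda>x. _ * cnj x"] cong: if_cong)
    finally show ?thesis .
  qed
  \<comment> \<open>Both terms factor through \<open>A\<close>: \<open>K f\<close> is the full frame
    operator at \<open>A f\<close>, and the subtracted term is its part over \<sigma>.\<close>
  have "K f - synthesis F \<sigma> (analysis (canonical_K_dual K F) \<sigma> f) = ?S (A f)" for f
  proof -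
    have "synthesis F \<sigma> (analysis (canonical_K_dual K F) \<sigma> f) = frame_operator F \<sigma> (A f)"
      by (simp add: frame_operator_def analysis_def dual cong: if_cong)
    moreover have "K f = frame_operator F UNIV (A f)"
      using parseval KKA by simp
    ultimately show ?thesis
      using frame_operator_split_Compl[of F "A f" \<sigma>] by simp
  qed
  then have op: "(\<lambda>f. K f - synthesis F \<sigma> (analysis (canonical_K_dual K F) \<sigma> f)) = ?S \<circ> A"
    by (simp add: fun_eq_iff)
  have "inj_on ?S (range K)"
  proof (rule inj_onI)
    fix x y assume "x \<in> range K" "y \<in> range K" and eq: "?S x = ?S y"
    then obtain u v where uv: "x = K u" "y = K v" by blast
    have "?S (K (u - v)) = 0"
      using eq by (simp add: uv clinear_diff[OF K] clinear_diff[OF clinear_frame_operator])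
    then have "K (u - v) = 0"
      using K_frame_analysis_eq_0[OF frame] by (simp add: frame_operator_eq_0_iff)
    then show "x = y"
      by (simp add: uv clinear_diff[OF K])
  qed
  then have bij: "bij_betw (?S \<circ> A) (range X) (?S ` range K)"
    using bij_A inj_on_imp_bij_betw bij_betw_trans by blast
  have lin: "clinear (?S \<circ> A)"
    using clinear_frame_operator A by (rule clinear_compose)
  have "complex_vector.subspace (?S ` range K)"
    using clinear_subspace_range[OF clinear_compose[OF clinear_frame_operator K]] by (simp add: image_comp)
  then show "invertible_operator_on
        (\<lambda>f. K f - synthesis F \<sigma> (analysis (canonical_K_dual K F) \<sigma> f))
        (range (pseudo_inverse K)) (?S ` range K)"
    unfolding op invertible_operator_on_def X_def[symmetric]
    using bij clinear_subspace_range[OF X] clinear_add[OF lin] clinear_scale[OF lin] by blast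
qed

end
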